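(* Let $S$ be a nonempty commutative semigroup, let $G$ be a group, let $\iota:G\to G$, $x\mapsto x^{-1}$, be the inverse function, and let $f:S\to G$ be a polynomial map of lc-height $k$ and degree $d$. Then the composition $\iota\circ f:S\to G$ is a polynomial map of lc-height $k$ and degree $d$.
   Context: The lower central series is $C^1G=G$, $C^{i+1}G=[C^iG,G]$. A function $f:S\to G$ has lc-height $k$ (or $\ge k$) if its image lies in $C^kG$. Let $S$ be a nonempty commutative semigroup (written additively) and $G$ a group with identity $1_G$. A map $f:S\to G$ is a polynomial map of degree $-\infty$ if $f(s)=1_G$ for all $s$, and of degree $0$ if it is constant with value different from $1_G$. Thus degree $\le 0$ means constant. Inductively, for $d\in\{0,1,2,\dots\}$, $f$ is a polynomial map of degree $\le d+1$ if for every $s\in S$ both maps $L_s(f):t\mapsto f(s+t)f(t)^{-1}$ and $R_s(f):t\mapsto f(t)^{-1}f(s+t)$ from $S$ to $G$ are polynomial maps of degree $\le d$. The degree of a polynomial map is the least such $d\in\{-\infty,0,1,2,\dots\}$. A map is a polynomial map if it is a polynomial map of degree $\le d$ for some $d$. *)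

theory Defs
  imports "HOL-Algebra.Generated_Groups" "HOL-Library.Option_ord"
begin

locale nonempty_comm_semigroup =
  fixes S :: "'s set" and add :: "'s \<Rightarrow> 's \<Rightarrow> 's" (infixl \<open>\<oplus>\<^sub>S\<close> 65)
  assumes nonempty: "S \<noteq> {}"
    and add_closed: "\<lbrakk>x \<in> S; y \<in> S\<rbrakk> \<Longrightarrow> x \<oplus>\<^sub>S y \<in> S"
    and add_assoc: "\<lbrakk>x \<in> S; y \<in> S; z \<in> S\<rbrakk> \<Longrightarrow> (x \<oplus>\<^sub>S y) \<oplus>\<^sub>S z = x \<oplus>\<^sub>S (y \<oplus>\<^sub>S z)"
    and add_commute: "\<lbrakk>x \<in> S; y \<in> S\<rbrakk> \<Longrightarrow> x \<oplus>\<^sub>S y = y \<oplus>\<^sub>S x"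

text \<open>The commutator \<open>h k h\<inverse> k\<inverse>\<close> follows the convention of \<open>derived\<close>, which is the
  case \<open>H = K\<close>.\<close>

definition commutator_subgroup ::
    "('g, 'm) monoid_scheme \<Rightarrow> 'g set \<Rightarrow> 'g set \<Rightarrow> 'g set" where
  "commutator_subgroup G H K =
     generate G (\<Union>h\<in>H. \<Union>k\<in>K. {h \<otimes>\<^bsub>G\<^esub> k \<otimes>\<^bsub>G\<^esub> inv\<^bsub>G\<^esub> h \<otimes>\<^bsub>G\<^esub> inv\<^bsub>G\<^esub> k})"

text \<open>The series starts at index 1; the value at index 0 is a dummy.\<close>

fun lower_central_series :: "('g, 'm) monoid_scheme \<Rightarrow> nat \<Rightarrow> 'g set" where
  "lower_central_series G 0 = carrier G"
| "lower_central_series G (Suc 0) = carrier G"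
| "lower_central_series G (Suc (Suc i)) =
     commutator_subgroup G (lower_central_series G (Suc i)) (carrier G)"

definition lc_height ::
    "'s set \<Rightarrow> ('g, 'm) monoid_scheme \<Rightarrow> nat \<Rightarrow> ('s \<Rightarrow> 'g) \<Rightarrow> bool" where
  "lc_height S G k f \<longleftrightarrow> f ` S \<subseteq> lower_central_series G k"

definition left_difference ::
    "('s \<Rightarrow> 's \<Rightarrow> 's) \<Rightarrow> ('g, 'm) monoid_scheme \<Rightarrow> 's \<Rightarrow> ('s \<Rightarrow> 'g) \<Rightarrow> 's \<Rightarrow> 'g" where
  "left_difference add G s f = (\<lambda>t. f (add s t) \<otimes>\<^bsub>G\<^esub> inv\<^bsub>G\<^esub> (f t))"

definition right_difference ::
    "('s \<Rightarrow> 's \<Rightarrow> 's) \<Rightarrow> ('g, 'm) monoid_scheme \<Rightarrow> 's \<Rightarrow> ('s \<Rightarrow> 'g) \<Rightarrow> 's \<Rightarrow> 'g" where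
  "right_difference add G s f = (\<lambda>t. inv\<^bsub>G\<^esub> (f t) \<otimes>\<^bsub>G\<^esub> f (add s t))"

text \<open>Degrees are of type \<^typ>\<open>nat option\<close>, where \<^term>\<open>None\<close> stands for \<open>-\<infinity>\<close>; it is the
  least element of the order on this type. The predicate below means
  ``polynomial map of degree at most the given bound''.\<close>

fun poly_map_degree_le ::
    "'s set \<Rightarrow> ('s \<Rightarrow> 's \<Rightarrow> 's) \<Rightarrow> ('g, 'm) monoid_scheme \<Rightarrow> nat option \<Rightarrow> ('s \<Rightarrow> 'g) \<Rightarrow> bool" where
  "poly_map_degree_le S add G None f \<longleftrightarrow>
     f \<in> S \<rightarrow> carrier G \<and> (\<forall>s\<in>S. f s = \<one>\<^bsub>G\<^esub>)"
| "poly_map_degree_le S add G (Some 0) f \<longleftrightarrow>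
     f \<in> S \<rightarrow> carrier G \<and> (\<exists>c\<in>carrier G. \<forall>s\<in>S. f s = c)"
| "poly_map_degree_le S add G (Some (Suc d)) f \<longleftrightarrow>
     f \<in> S \<rightarrow> carrier G \<and>
     (\<forall>s\<in>S. poly_map_degree_le S add G (Some d) (left_difference add G s f) \<and>
             poly_map_degree_le S add G (Some d) (right_difference add G s f))"

definition polynomial_map ::
    "'s set \<Rightarrow> ('s \<Rightarrow> 's \<Rightarrow> 's) \<Rightarrow> ('g, 'm) monoid_scheme \<Rightarrow> ('s \<Rightarrow> 'g) \<Rightarrow> bool" where
  "polynomial_map S add G f \<longleftrightarrow> (\<exists>d. poly_map_degree_le S add G d f)"

text \<open>Meaningful for polynomial maps only.\<close>

definition poly_map_degree ::
    "'s set \<Rightarrow> ('s \<Rightarrow> 's \<Rightarrow> 's) \<Rightarrow> ('g, 'm) monoid_scheme \<Rightarrow> ('s \<Rightarrow> 'g) \<Rightarrow> nat option" where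
  "poly_map_degree S add G f = (LEAST d. poly_map_degree_le S add G d f)"

end

theory Submission
  imports Defs
begin

text \<open>Inversion exchanges the two kinds of difference: if \<open>g = f\<inverse>\<close> pointwise, then
  \<open>L\<^sub>s(g)(t) = f(s+t)\<inverse> f(t) = (R\<^sub>s(f)(t))\<inverse>\<close> and
  \<open>R\<^sub>s(g)(t) = f(t) f(s+t)\<inverse> = (L\<^sub>s(f)(t))\<inverse>\<close>.
  Since the definition of degree is symmetric in \<open>L\<close> and \<open>R\<close>, induction on the degree bound
  shows that \<open>g\<close> satisfies every bound that \<open>f\<close> satisfies
  (\<open>poly_map_degree_le_pointwise_inv\<close>). As inversion is an involution, \<open>f\<close> and \<open>g\<close> satisfy the
  same bounds and hence have the same degree. The lc-height is preserved because the terms of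
  the lower central series are subgroups.\<close>

lemma (in group) commutator_subgroup_is_subgroup:
  assumes "H \<subseteq> carrier G" and "K \<subseteq> carrier G"
  shows "subgroup (commutator_subgroup G H K) G"
  unfolding commutator_subgroup_def
  using assms by (intro generate_is_subgroup) blast

lemma (in group) lower_central_series_subgroup:
  "subgroup (lower_central_series G k) G"
proof (induction k)
  case 0
  show ?case by (simp add: subgroup_self)
next
  case (Suc k)
  then show ?case
    by (cases k)
      (simp_all add: subgroup_self commutator_subgroup_is_subgroup subgroup.subset)
qed

lemma poly_map_degree_le_imp_closed:
  "poly_map_degree_le S add G d f \<Longrightarrow> f \<in> S \<rightarrow> carrier G"
  by (cases "(S, add, G, d, f)" rule: poly_map_degree_le.cases) simp_all

text \<open>The pointwise inverse is given by a hypothesis on \<open>S\<close> rather than as a composition with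
  \<open>m_inv G\<close>. The induction needs this, because the difference of an inverse agrees with the
  inverse of a difference on \<open>S\<close> only; the same freedom lets the lemma be applied with \<open>f\<close> and
  \<open>g\<close> exchanged.\<close>

lemma (in group) poly_map_degree_le_pointwise_inv:
  assumes closed: "\<And>s t. \<lbrakk>s \<in> S; t \<in> S\<rbrakk> \<Longrightarrow> add s t \<in> S"
    and "poly_map_degree_le S add G d f"
    and "\<And>s. s \<in> S \<Longrightarrow> g s = inv (f s)"
  shows "poly_map_degree_le S add G d g"
proof (cases d)
  case None
  then show ?thesis using assms(2,3) by simp
next
  case (Some n)
  have "poly_map_degree_le S add G (Some n) g"
    using assms(2)[unfolded Some] assms(3)
  proof (induction n arbitrary: f g)
    case 0
    then show ?case by (fastforce simp: Pi_iff)
  next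
    case (Suc n)
    have f: "f t \<in> carrier G" if "t \<in> S" for t
      using Suc.prems(1) that by auto
    have "poly_map_degree_le S add G (Some n) (left_difference add G s g)" if s: "s \<in> S" for s
    proof (rule Suc.IH)
      show "poly_map_degree_le S add G (Some n) (right_difference add G s f)"
        using Suc.prems(1) s by simp
      show "left_difference add G s g t = inv (right_difference add G s f t)" if "t \<in> S" for t
        using s that
        by (simp add: left_difference_def right_difference_def Suc.prems(2) f closed
            inv_mult_group)
    qed
    moreover have "poly_map_degree_le S add G (Some n) (right_difference add G s g)"
      if s: "s \<in> S" for s
    proof (rule Suc.IH)
      show "poly_map_degree_le S add G (Some n) (left_difference add G s f)"
        using Suc.prems(1) s by simp
      show "right_difference add G s g t = inv (left_difference add G s f t)" if "t \<in> S" for t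
        using s that
        by (simp add: left_difference_def right_difference_def Suc.prems(2) f closed
            inv_mult_group)
    qed
    moreover have "g \<in> S \<rightarrow> carrier G"
      using f Suc.prems(2) by simp
    ultimately show ?case by simp
  qed
  then show ?thesis using Some by simp
qed

theorem corollary3:
  fixes S :: "'s set" and add :: "'s \<Rightarrow> 's \<Rightarrow> 's"
    and G :: "('g, 'm) monoid_scheme"
    and f :: "'s \<Rightarrow> 'g" and k :: nat and d :: "nat option"
  assumes "nonempty_comm_semigroup S add"
    and "group G"
    and "k \<ge> 1"
    and "polynomial_map S add G f"
    and "lc_height S G k f"
    and "poly_map_degree S add G f = d"
  shows "polynomial_map S add G (m_inv G \<circ> f)
    \<and> lc_height S G k (m_inv G \<circ> f)
    \<and> poly_map_degree S add G (m_inv G \<circ> f) = d"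
proof -
  interpret group G by fact
  have closed: "add s t \<in> S" if "s \<in> S" "t \<in> S" for s t
    using assms(1) that by (rule nonempty_comm_semigroup.add_closed)
  have f: "f s \<in> carrier G" if "s \<in> S" for s
    using assms(4) poly_map_degree_le_imp_closed that
    unfolding polynomial_map_def by blast
  have degree_le_iff:
    "poly_map_degree_le S add G e (m_inv G \<circ> f) \<longleftrightarrow> poly_map_degree_le S add G e f" for e
  proof
    assume "poly_map_degree_le S add G e (m_inv G \<circ> f)"
    with closed show "poly_map_degree_le S add G e f"
      by (rule poly_map_degree_le_pointwise_inv) (simp_all add: f)
  next
    assume "poly_map_degree_le S add G e f"
    with closed show "poly_map_degree_le S add G e (m_inv G \<circ> f)"
      by (rule poly_map_degree_le_pointwise_inv) simp_all
  qed
  have "polynomial_map S add G (m_inv G \<circ> f)"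
    using assms(4) by (simp add: polynomial_map_def degree_le_iff)
  moreover have "lc_height S G k (m_inv G \<circ> f)"
    using assms(5) subgroup.m_inv_closed[OF lower_central_series_subgroup]
    unfolding lc_height_def by auto
  moreover have "poly_map_degree S add G (m_inv G \<circ> f) = d"
    using assms(6) by (simp add: poly_map_degree_def degree_le_iff)
  ultimately show ?thesis by blast
qed

end
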